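(* Let $d\ge1$ and let $\beta$ be a Pisot number with minimal polynomial $(x-\beta)(x^d+r_{d-1}x^{d-1}+\cdots+r_0)$ and with $d=p+2s$ Galois conjugates $\beta_1,\ldots,\beta_p\in\mathbb{R}$, $\beta_{p+1},\ldots,\beta_{p+2s}\in\mathbb{C}\setminus\mathbb{R}$ (other than $\beta$), ordered such that $\beta_{p+1}=\overline{\beta_{p+s+1}},\ldots,\beta_{p+s}=\overline{\beta_{p+2s}}$. For $1\le j\le d$ write $$x^d+r_{d-1}x^{d-1}+\cdots+r_0=(x-\beta_j)\big(x^{d-1}+q^{(j)}_{d-2}x^{d-2}+\cdots+q^{(j)}_0\big),$$ and let $U\in\mathbb{R}^{d\times d}$ be the matrix whose rows are, in this order, $(q_0^{(j)},q_1^{(j)},\ldots,q_{d-2}^{(j)},1)$ for $j=1,\ldots,p$, followed, for $j=p+1,\ldots,p+s$, by the two rows $(\Re q_0^{(j)},\Re q_1^{(j)},\ldots,\Re q_{d-2}^{(j)},1)$ and $(\Im q_0^{(j)},\Im q_1^{(j)},\ldots,\Im q_{d-2}^{(j)},0)$. Let $\mathbf{r}=(r_0,\ldots,r_{d-1})$ and let $I_d$ be the $d\times d$ identity matrix. Then $$\mathcal{S}_\beta(\{\mathbf{r}\mathbf{x}\})=U(M_\mathbf{r}-\beta I_d)\,\mathcal{T}_\mathbf{r}(\mathbf{x})\quad\text{for every }\mathbf{x}\in\mathbb{Z}^d.$$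
   Context: A Pisot number is an algebraic integer $\beta>1$ all of whose other Galois conjugates have modulus $<1$. $\{y\}=y-\lfloor y\rfloor$ is the fractional part. The lower Hausdorff limit $\mathrm{Li}_{n\to\infty}A_n$ of subsets $A_n\subseteq\mathbb{R}^d$ is the set of all $\mathbf{t}\in\mathbb{R}^d$ such that each neighbourhood of $\mathbf{t}$ intersects $A_n$ for all sufficiently large $n$. SRS tiles. For $\mathbf{r}=(r_0,\ldots,r_{d-1})\in\mathbb{R}^d$ and $\mathbf{z}=(z_0,\ldots,z_{d-1})^t\in\mathbb{Z}^d$ put $\mathbf{r}\mathbf{z}=\sum_ir_iz_i$, $\tau_\mathbf{r}(\mathbf{z})=(z_1,\ldots,z_{d-1},-\lfloor\mathbf{r}\mathbf{z}\rfloor)^t\in\mathbb{Z}^d$, $\tau_\mathbf{r}^{-n}(\mathbf{x})=\{\mathbf{z}\in\mathbb{Z}^d\mid\tau_\mathbf{r}^n(\mathbf{z})=\mathbf{x}\}$. The companion matrix $M_\mathbf{r}\in\mathbb{R}^{d\times d}$ has last row $(-r_0,\ldots,-r_{d-1})$, entries $1$ on the superdiagonal of the first $d-1$ rows, and $0$ elsewhere (for $d=1$, $M_\mathbf{r}=(-r_0)$). If $r_0\ne0$ and $M_\mathbf{r}$ has spectral radius $<1$ (true here, since the eigenvalues of $M_\mathbf{r}$ are $\beta_1,\dots,\beta_d$), the SRS tile is $\mathcal{T}_\mathbf{r}(\mathbf{x})=\mathrm{Li}_{n\to\infty}M_\mathbf{r}^n\tau_\mathbf{r}^{-n}(\mathbf{x})$,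 $\mathbf{x}\in\mathbb{Z}^d$. Integral beta-tiles. $T_\beta:[0,1)\to[0,1)$, $T_\beta(x)=\{\beta x\}$, $T_\beta^{-n}(x)=\{y\in[0,1)\mid T_\beta^n(y)=x\}$. For $x\in\mathbb{Q}(\beta)$ let $x^{(j)}$ be the image of $x$ under the field isomorphism $\mathbb{Q}(\beta)\to\mathbb{Q}(\beta_j)$, $\beta\mapsto\beta_j$, and $\Phi_\beta(x)=\big(x^{(1)},\ldots,x^{(p)},\Re x^{(p+1)},\Im x^{(p+1)},\ldots,\Re x^{(p+s)},\Im x^{(p+s)}\big)^t\in\mathbb{R}^d$. For $x\in\mathbb{Z}[\beta]\cap[0,1)$ the integral $\beta$-tile is $\mathcal{S}_\beta(x)=\mathrm{Li}_{n\to\infty}\Phi_\beta\big(\beta^n(T_\beta^{-n}(x)\cap\mathbb{Z}[\beta])\big)$. Note $\{\mathbf{r}\mathbf{x}\}\in\mathbb{Z}[\beta]\cap[0,1)$ for $\mathbf{x}\in\mathbb{Z}^d$. *)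

theory Defs
  imports
    "HOL-Computational_Algebra.Polynomial"
    "Jordan_Normal_Form.Matrix"
begin

definition minimal_polynomial :: "'a::field_char_0 \<Rightarrow> rat poly \<Rightarrow> bool" where
  "minimal_polynomial x m \<longleftrightarrow>
     lead_coeff m = 1 \<and> poly (map_poly of_rat m) x = 0 \<and>
     (\<forall>f. f \<noteq> 0 \<and> poly (map_poly of_rat f) x = 0 \<longrightarrow> degree m \<le> degree f)"

definition galois_conjugate :: "real \<Rightarrow> complex \<Rightarrow> bool" where
  "galois_conjugate x z \<longleftrightarrow>
     (\<exists>m. minimal_polynomial x m \<and> poly (map_poly of_rat m) z = 0)"

definition pisot :: "real \<Rightarrow> bool" where
  "pisot \<beta> \<longleftrightarrow> algebraic_int \<beta> \<and> \<beta> > 1 \<and>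
     (\<forall>z. galois_conjugate \<beta> z \<and> z \<noteq> of_real \<beta> \<longrightarrow> cmod z < 1)"

definition monic_poly :: "nat \<Rightarrow> (nat \<Rightarrow> 'a::comm_semiring_1) \<Rightarrow> 'a poly" where
  "monic_poly n c = monom 1 n + (\<Sum>i<n. monom (c i) i)"

(* Euclidean neighbourhoods, spelled out because the type of vectors of
   Jordan_Normal_Form, which covers all dimensions, carries no topology. *)
definition lower_hausdorff_limit :: "nat \<Rightarrow> (nat \<Rightarrow> real vec set) \<Rightarrow> real vec set" where
  "lower_hausdorff_limit d A =
     {t \<in> carrier_vec d. \<forall>\<epsilon>>0. \<exists>N. \<forall>n\<ge>N. \<exists>a\<in>A n.
        a \<in> carrier_vec d \<and> sqrt (\<Sum>i<d. (a $ i - t $ i)\<^sup>2) < \<epsilon>}"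

definition srs_map :: "real vec \<Rightarrow> int vec \<Rightarrow> int vec" where
  "srs_map r z = vec (dim_vec r)
     (\<lambda>i. if i + 1 < dim_vec r then z $ (i + 1) else - \<lfloor>r \<bullet> map_vec of_int z\<rfloor>)"

definition companion_matrix :: "real vec \<Rightarrow> real mat" where
  "companion_matrix r = mat (dim_vec r) (dim_vec r)
     (\<lambda>(i, k). if i = dim_vec r - 1 then - (r $ k) else if k = i + 1 then 1 else 0)"

definition srs_preimage :: "real vec \<Rightarrow> nat \<Rightarrow> int vec \<Rightarrow> int vec set" where
  "srs_preimage r n x = {z \<in> carrier_vec (dim_vec r). (srs_map r ^^ n) z = x}"

definition srs_tile :: "real vec \<Rightarrow> int vec \<Rightarrow> real vec set" where
  "srs_tile r x = lower_hausdorff_limit (dim_vec r)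
     (\<lambda>n. (\<lambda>z. (companion_matrix r ^\<^sub>m n) *\<^sub>v map_vec of_int z) ` srs_preimage r n x)"

definition is_subfield :: "'a::field set \<Rightarrow> bool" where
  "is_subfield K \<longleftrightarrow> 0 \<in> K \<and> 1 \<in> K \<and>
     (\<forall>x\<in>K. \<forall>y\<in>K. x - y \<in> K \<and> x * y \<in> K) \<and> (\<forall>x\<in>K. inverse x \<in> K)"

definition rat_adjoin :: "'a::field_char_0 \<Rightarrow> 'a set" where
  "rat_adjoin a = \<Inter>{K. is_subfield K \<and> a \<in> K}"

definition field_iso_on :: "'a::field set \<Rightarrow> 'b::field set \<Rightarrow> ('a \<Rightarrow> 'b) \<Rightarrow> bool" where
  "field_iso_on K L \<sigma> \<longleftrightarrow> bij_betw \<sigma> K L \<and> \<sigma> 1 = 1 \<and>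
     (\<forall>x\<in>K. \<forall>y\<in>K. \<sigma> (x + y) = \<sigma> x + \<sigma> y \<and> \<sigma> (x * y) = \<sigma> x * \<sigma> y)"

(* The field isomorphism from Q(\<beta>) to Q(b) sending \<beta> to b.
   It is unique on Q(\<beta>), but its values outside are arbitrary, hence SOME rather than THE. *)
definition conj_iso :: "real \<Rightarrow> complex \<Rightarrow> real \<Rightarrow> complex" where
  "conj_iso \<beta> b = (SOME \<sigma>. field_iso_on (rat_adjoin \<beta>) (rat_adjoin b) \<sigma> \<and> \<sigma> \<beta> = b)"

(* Entry i, counted from 0, of the real vector
   (w 1, ..., w p, Re (w (p+1)), Im (w (p+1)), ..., Re (w (p+s)), Im (w (p+s)));
   w 1, ..., w p are meant to be real. *)
definition real_coord :: "nat \<Rightarrow> (nat \<Rightarrow> complex) \<Rightarrow> nat \<Rightarrow> real" where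
  "real_coord p w i =
     (if i < p then Re (w (i + 1))
      else if even (i - p) then Re (w (p + 1 + (i - p) div 2))
      else Im (w (p + 1 + (i - p) div 2)))"

(* The conjugates b 1, ..., b (p+2s) are numbered from 1. *)
definition Phi :: "real \<Rightarrow> (nat \<Rightarrow> complex) \<Rightarrow> nat \<Rightarrow> nat \<Rightarrow> real \<Rightarrow> real vec" where
  "Phi \<beta> b p s x = vec (p + 2 * s) (real_coord p (\<lambda>j. conj_iso \<beta> (b j) x))"

definition beta_map :: "real \<Rightarrow> real \<Rightarrow> real" where
  "beta_map \<beta> x = frac (\<beta> * x)"

definition beta_preimage :: "real \<Rightarrow> nat \<Rightarrow> real \<Rightarrow> real set" where
  "beta_preimage \<beta> n x = {y \<in> {0..<1}. (beta_map \<beta> ^^ n) y = x}"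

definition int_adjoin :: "real \<Rightarrow> real set" where
  "int_adjoin \<beta> = range (\<lambda>f :: int poly. poly (map_poly of_int f) \<beta>)"

definition integral_beta_tile ::
    "real \<Rightarrow> (nat \<Rightarrow> complex) \<Rightarrow> nat \<Rightarrow> nat \<Rightarrow> real \<Rightarrow> real vec set" where
  "integral_beta_tile \<beta> b p s x = lower_hausdorff_limit (p + 2 * s)
     (\<lambda>n. (\<lambda>y. Phi \<beta> b p s (\<beta> ^ n * y)) ` (beta_preimage \<beta> n x \<inter> int_adjoin \<beta>))"

(* The last column holds the leading coefficient 1 of the cofactors,
   of which q j k are the coefficients below the leading one. *)
definition U_matrix :: "nat \<Rightarrow> nat \<Rightarrow> (nat \<Rightarrow> nat \<Rightarrow> complex) \<Rightarrow> real mat" where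
  "U_matrix p s q = mat (p + 2 * s) (p + 2 * s)
     (\<lambda>(i, k). real_coord p (\<lambda>j. if k = p + 2 * s - 1 then 1 else q j k) i)"

end

theory Submission
  imports
    Defs
    "Jordan_Normal_Form.Determinant"
    "HOL-Analysis.L2_Norm"
    "Berlekamp_Zassenhaus.Factor_Bound"
begin

text \<open>
The map \<open>z \<mapsto> {r z}\<close> is a bijection from \<open>\<int>\<^sup>d\<close> onto \<open>\<int>[\<beta>] \<inter> [0,1)\<close>, because
\<open>1, r\<^sub>0, \<dots>, r\<^bsub>d-1\<^esub>\<close> is a \<open>\<int>\<close>-basis of \<open>\<int>[\<beta>]\<close>, and it conjugates the shift radix
map to the \<open>\<beta>\<close>-transformation. Hence the sets of preimages on both sides correspond to each other.
The rows \<open>u\<^sub>j\<close> of cofactor coefficients are left eigenvectors of the companion matrix \<open>M\<close> for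
\<open>\<beta>\<^sub>j\<close>, and the \<open>j\<close>-th conjugate of \<open>{r z}\<close> is \<open>(\<beta>\<^sub>j - \<beta>) u\<^sub>j z + {r z}\<close>. So the
\<open>j\<close>-th coordinates of \<open>\<Phi>(\<beta>\<^sup>n {r z})\<close> and \<open>U (M - \<beta> I) M\<^sup>n z\<close> differ by
\<open>\<beta>\<^sub>j\<^sup>n {r z}\<close>, which tends to 0 uniformly in \<open>z\<close>. As \<open>U (M - \<beta> I)\<close> is invertible,
the lower limits agree up to this linear map.
\<close>

subsection \<open>Conjugation of number fields\<close>

hide_const (open) up_ring.coeff up_ring.monom module.smult

interpretation of_rat_poly_hom: map_poly_idom_hom "of_rat :: rat \<Rightarrow> 'a::field_char_0" ..

interpretation of_real_poly_hom: map_poly_idom_hom "of_real :: real \<Rightarrow> complex" ..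

lemma minimal_polynomial_dvd:
  assumes "minimal_polynomial x m" "poly (map_poly of_rat f) x = 0"
  shows "m dvd f"
proof -
  have m: "lead_coeff m = 1" "poly (map_poly of_rat m) x = 0"
    "\<And>g. g \<noteq> 0 \<Longrightarrow> poly (map_poly of_rat g) x = 0 \<Longrightarrow> degree m \<le> degree g"
    using assms(1) by (auto simp: minimal_polynomial_def)
  have "m \<noteq> 0" using m(1) by auto
  have "map_poly of_rat f = map_poly of_rat (f div m) * map_poly of_rat m + map_poly of_rat (f mod m)"
    by (simp flip: of_rat_poly_hom.hom_mult of_rat_poly_hom.hom_add)
  from arg_cong[OF this, of "\<lambda>g. poly g x"] have "poly (map_poly of_rat (f mod m)) x = 0"
    unfolding poly_add poly_mult assms(2) m(2) by simp
  then have "f mod m = 0"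
    using m(3)[of "f mod m"] degree_mod_less[OF \<open>m \<noteq> 0\<close>, of f] by fastforce
  then show ?thesis by auto
qed

text \<open>In any factorization one factor vanishes at \<open>x\<close>; by minimality it already
  has the full degree, so the other factor is constant.\<close>

lemma minimal_polynomial_irreducible:
  fixes x :: "'a::field_char_0"
  assumes "minimal_polynomial x m"
  shows "irreducible m"
proof (rule irreducibleI)
  have m: "lead_coeff m = 1" "poly (map_poly of_rat m) x = 0"
    using assms by (auto simp: minimal_polynomial_def)
  then show "m \<noteq> 0" by auto
  have "degree m \<noteq> 0"
  proof
    assume "degree m = 0"
    then obtain c where "m = [:c:]" by (metis degree_eq_zeroE)
    with m show False by auto
  qed
  then show "\<not> m dvd 1" using is_unit_iff_degree[OF \<open>m \<noteq> 0\<close>] by auto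
  have *: "b dvd 1" if "m = a * b" "poly (map_poly of_rat a) x = 0" for a b
  proof -
    have "m dvd a" by (rule minimal_polynomial_dvd[OF assms that(2)])
    have "a \<noteq> 0" "b \<noteq> 0" using \<open>m \<noteq> 0\<close> that by auto
    have "degree m \<le> degree a" using \<open>m dvd a\<close> \<open>a \<noteq> 0\<close> by (rule dvd_imp_degree_le)
    then have "degree b = 0" using that \<open>a \<noteq> 0\<close> \<open>b \<noteq> 0\<close> by (simp add: degree_mult_eq)
    then show ?thesis using is_unit_iff_degree[OF \<open>b \<noteq> 0\<close>] by auto
  qed
  show "a dvd 1 \<or> b dvd 1" if "m = a * b" for a b
  proof -
    have "poly (map_poly of_rat a) x = 0 \<or> poly (map_poly of_rat b) x = 0"
      using m(2) that by (simp add: of_rat_poly_hom.hom_mult)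
    with * that show ?thesis by (metis mult.commute)
  qed
qed

text \<open>Bezout: \<open>m\<close> is prime and does not divide \<open>f\<close>, so
  \<open>v * m + w * f = 1\<close> for some \<open>v\<close> and \<open>w\<close>, and evaluation at
  \<open>y\<close> removes the first term.\<close>

lemma irreducible_root_inverse:
  fixes y :: "'a::field_char_0" and m :: "rat poly"
  assumes "irreducible m" "poly (map_poly of_rat m) y = 0" "\<not> m dvd f"
  shows "\<exists>w. poly (map_poly of_rat w) y * poly (map_poly of_rat f) y = 1"
proof -
  have "Rings.coprime m f"
    by (rule prime_elem_imp_coprime[OF irreducible_imp_prime_elem[OF assms(1)] assms(3)])
  moreover obtain v w where "bezout_coefficients m f = (v, w)" by force
  ultimately have "v * m + w * f = 1" using bezout_coefficients[of m f v w] by simp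
  then have "poly (map_poly of_rat (v * m + w * f)) y = 1" by simp
  then show ?thesis
    unfolding of_rat_poly_hom.hom_add of_rat_poly_hom.hom_mult poly_add poly_mult assms(2)
    by auto
qed

text \<open>The right-hand side does not mention \<open>y\<close>, so all roots of \<open>m\<close>,
  even in different fields, satisfy the same rational polynomial equations. This is what makes
  conjugation well defined.\<close>

lemma irreducible_root_iff_dvd:
  fixes y :: "'a::field_char_0" and m :: "rat poly"
  assumes "irreducible m" "poly (map_poly of_rat m) y = 0"
  shows "poly (map_poly of_rat f) y = 0 \<longleftrightarrow> m dvd f"
proof
  assume "m dvd f"
  then show "poly (map_poly of_rat f) y = 0"
    using assms(2) by (auto simp: of_rat_poly_hom.hom_mult elim!: dvdE)
next
  assume "poly (map_poly of_rat f) y = 0"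
  then show "m dvd f" using irreducible_root_inverse[OF assms, of f] by auto
qed

lemma is_subfield_of_rat:
  fixes K :: "'a::field_char_0 set"
  assumes "is_subfield K"
  shows "of_rat c \<in> K"
proof -
  have K: "0 \<in> K" "1 \<in> K" "\<And>x y. x \<in> K \<Longrightarrow> y \<in> K \<Longrightarrow> x - y \<in> K"
    "\<And>x y. x \<in> K \<Longrightarrow> y \<in> K \<Longrightarrow> x * y \<in> K" "\<And>x. x \<in> K \<Longrightarrow> inverse x \<in> K"
    using assms by (auto simp: is_subfield_def)
  have neg: "- x \<in> K" if "x \<in> K" for x using K(3)[OF K(1) that] by simp
  have add: "x + y \<in> K" if "x \<in> K" "y \<in> K" for x y using K(3)[OF that(1) neg[OF that(2)]] by simp
  have "of_nat n \<in> K" for n by (induction n) (use K add in auto)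
  then have int: "of_int n \<in> K" for n by (cases n rule: int_cases2) (use neg in auto)
  obtain a b where "c = of_int a / of_int b"
    by (metis quotient_of_div surj_pair)
  then have "of_rat c = of_int a * inverse (of_int b :: 'a)"
    by (simp add: of_rat_divide field_simps)
  then show ?thesis using K(4)[OF int[of a] K(5)[OF int[of b]]] by simp
qed

text \<open>The polynomial values already form a field, since nonzero ones have polynomial inverses
  by \<open>irreducible_root_inverse\<close>; conversely, Horner's scheme stays inside every
  subfield containing \<open>y\<close>.\<close>

lemma rat_adjoin_eq:
  fixes y :: "'a::field_char_0" and m :: "rat poly"
  assumes "irreducible m" "poly (map_poly of_rat m) y = 0"
  shows "rat_adjoin y = range (\<lambda>f. poly (map_poly of_rat f) y)" (is "_ = ?R")
proof
  have "is_subfield ?R"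
    unfolding is_subfield_def
  proof (intro conjI ballI)
    show "0 \<in> ?R" by (rule range_eqI[of _ _ 0]) simp
    show "1 \<in> ?R" by (rule range_eqI[of _ _ 1]) simp
    fix u assume "u \<in> ?R"
    then obtain f where f: "u = poly (map_poly of_rat f) y" by auto
    show "inverse u \<in> ?R"
    proof (cases "u = 0")
      case True
      then show ?thesis by (intro range_eqI[of _ _ 0]) simp
    next
      case False
      then have "\<not> m dvd f" using irreducible_root_iff_dvd[OF assms] f by simp
      then obtain w where "poly (map_poly of_rat w) y * u = 1"
        using irreducible_root_inverse[OF assms, of f] f by auto
      then have "inverse u = poly (map_poly of_rat w) y"
        using inverse_unique[of u] by (simp add: mult.commute)
      then show ?thesis by simp
    qed
    fix v assume "v \<in> ?R"
    then obtain g where g: "v = poly (map_poly of_rat g) y" by auto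
    show "u - v \<in> ?R" by (rule range_eqI[of _ _ "f - g"]) (simp add: f g of_rat_poly_hom.hom_minus)
    show "u * v \<in> ?R" by (rule range_eqI[of _ _ "f * g"]) (simp add: f g of_rat_poly_hom.hom_mult)
  qed
  moreover have "y \<in> ?R" by (rule range_eqI[of _ _ "[:0, 1:]"]) simp
  ultimately show "rat_adjoin y \<subseteq> ?R" by (auto simp: rat_adjoin_def)
next
  have "poly (map_poly of_rat f) y \<in> K" if "is_subfield K" "y \<in> K" for f K
  proof (induction f)
    case 0
    show ?case using that by (simp add: is_subfield_def)
  next
    case (pCons a f)
    define w where "w = poly (map_poly of_rat f) y"
    have K: "0 \<in> K" "\<And>x y. x \<in> K \<Longrightarrow> y \<in> K \<Longrightarrow> x - y \<in> K" "\<And>x y. x \<in> K \<Longrightarrow> y \<in> K \<Longrightarrow> x * y \<in> K"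
      using that by (auto simp: is_subfield_def)
    have "of_rat a - (0 - y * w) \<in> K"
      using K is_subfield_of_rat[OF that(1), of a] that(2) pCons.IH w_def by metis
    then show ?case using pCons.hyps by (simp add: w_def map_poly_pCons)
  qed
  then show "?R \<subseteq> rat_adjoin y" by (auto simp: rat_adjoin_def)
qed

text \<open>\<open>conj_iso\<close> is defined by choice, so an isomorphism has to be exhibited
  before anything can be said about it.\<close>

lemma conj_iso_spec:
  fixes m :: "rat poly"
  assumes m: "irreducible m" and x: "poly (map_poly of_rat m) x = 0" and b: "poly (map_poly of_rat m) b = 0"
  shows "field_iso_on (rat_adjoin x) (rat_adjoin b) (conj_iso x b) \<and> conj_iso x b x = b"
proof -
  \<comment> \<open>Candidate isomorphism: write \<open>u\<close> as a polynomial in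
    \<open>x\<close> and substitute \<open>b\<close>. The equivalence \<open>eq\<close> below shows
    that the chosen representative does not matter and that the map is injective.\<close>
  define \<sigma> where "\<sigma> u = poly (map_poly of_rat (SOME f. poly (map_poly of_rat f) x = u)) b" for u
  have eq: "poly (map_poly of_rat f) x = poly (map_poly of_rat g) x \<longleftrightarrow>
    poly (map_poly of_rat f) b = poly (map_poly of_rat g) b" for f g
    using irreducible_root_iff_dvd[OF m x, of "f - g"] irreducible_root_iff_dvd[OF m b, of "f - g"]
    by (simp add: of_rat_poly_hom.hom_minus)
  have \<sigma>: "\<sigma> (poly (map_poly of_rat f) x) = poly (map_poly of_rat f) b" for f
    unfolding \<sigma>_def eq[symmetric] by (rule someI[of _ f]) simp
  note adj = rat_adjoin_eq[OF m x] rat_adjoin_eq[OF m b]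
  have "\<sigma> 1 = 1" using \<sigma>[of 1] by simp
  moreover have "\<sigma> x = b" using \<sigma>[of "[:0, 1:]"] by simp
  moreover have "bij_betw \<sigma> (rat_adjoin x) (rat_adjoin b)"
    unfolding bij_betw_def adj by (auto simp: inj_on_def \<sigma> eq image_image)
  moreover have "\<sigma> (u + v) = \<sigma> u + \<sigma> v \<and> \<sigma> (u * v) = \<sigma> u * \<sigma> v"
    if uv: "u \<in> rat_adjoin x" "v \<in> rat_adjoin x" for u v
  proof -
    obtain f g where fg: "u = poly (map_poly of_rat f) x" "v = poly (map_poly of_rat g) x"
      using uv unfolding adj by auto
    show ?thesis using \<sigma>[of "f + g"] \<sigma>[of "f * g"] \<sigma>[of f] \<sigma>[of g]
      by (simp add: fg of_rat_poly_hom.hom_add of_rat_poly_hom.hom_mult)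
  qed
  ultimately have "\<exists>\<sigma>. field_iso_on (rat_adjoin x) (rat_adjoin b) \<sigma> \<and> \<sigma> x = b"
    by (auto simp: field_iso_on_def)
  then show ?thesis unfolding conj_iso_def by (rule someI_ex)
qed

text \<open>Elements of Z[\<beta>] are all that the tiles involve. The homomorphism laws determine
  \<open>conj_iso\<close> there: first on the integers, then along Horner's scheme.\<close>

lemma conj_iso_int_poly:
  fixes m :: "rat poly"
  assumes m: "irreducible m" and x: "poly (map_poly of_rat m) x = 0" and b: "poly (map_poly of_rat m) b = 0"
  shows "conj_iso x b (poly (map_poly of_int f) x) = poly (map_poly of_int f) b"
proof -
  define \<sigma> where "\<sigma> = conj_iso x b"
  have adj: "rat_adjoin x = range (\<lambda>f. poly (map_poly of_rat f) x)"
    by (rule rat_adjoin_eq[OF m x])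
  have mem: "poly (map_poly of_int f) x \<in> rat_adjoin x" for f
  proof -
    have "map_poly of_int f = (map_poly of_rat (map_poly of_int f) :: real poly)"
      by (simp add: poly_eq_iff)
    then show ?thesis unfolding adj by (metis rangeI)
  qed
  have x_mem: "x \<in> rat_adjoin x" using mem[of "[:0, 1:]"] by simp
  have int_mem: "of_int n \<in> rat_adjoin x" for n
  proof -
    have "poly (map_poly of_int [:n:]) x = of_int n" by (cases "n = 0") simp_all
    then show ?thesis using mem[of "[:n:]"] by metis
  qed
  have \<sigma>: "\<sigma> 1 = 1" "\<sigma> x = b"
    "\<And>u v. u \<in> rat_adjoin x \<Longrightarrow> v \<in> rat_adjoin x \<Longrightarrow> \<sigma> (u + v) = \<sigma> u + \<sigma> v"
    "\<And>u v. u \<in> rat_adjoin x \<Longrightarrow> v \<in> rat_adjoin x \<Longrightarrow> \<sigma> (u * v) = \<sigma> u * \<sigma> v"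
    using conj_iso_spec[OF m x b] by (auto simp: \<sigma>_def field_iso_on_def)
  have "\<sigma> 0 = 0" using \<sigma>(3)[of 0 0] int_mem[of 0] by simp
  have nat: "\<sigma> (of_nat n) = of_nat n" for n
  proof (induction n)
    case (Suc n)
    then show ?case using \<sigma>(1) \<sigma>(3)[of 1 "of_nat n"] int_mem[of 1] int_mem[of "int n"] by simp
  qed (simp add: \<open>\<sigma> 0 = 0\<close>)
  have int: "\<sigma> (of_int n) = of_int n" for n
  proof (cases n rule: int_cases2)
    case (nonneg k)
    then show ?thesis using nat by simp
  next
    case (nonpos k)
    then have "of_int n + of_nat k = (0::real)" "of_int n = - (of_nat k :: complex)" by simp_all
    moreover have "\<sigma> (of_int n + of_nat k) = \<sigma> (of_int n) + \<sigma> (of_nat k)"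
      using \<sigma>(3) int_mem[of n] int_mem[of "int k"] by simp
    ultimately show ?thesis using nat[of k] \<open>\<sigma> 0 = 0\<close> by (metis eq_neg_iff_add_eq_0)
  qed
  have "\<sigma> (poly (map_poly of_int f) x) = poly (map_poly of_int f) b"
  proof (induction f)
    case 0
    then show ?case by (simp add: \<open>\<sigma> 0 = 0\<close>)
  next
    case (pCons a f)
    define u where "u = poly (map_poly of_int f) x"
    have "poly (map_poly of_int ([:0, 1:] * f)) x = x * u"
      unfolding of_int_poly_hom.hom_mult poly_mult u_def by simp
    then have "u \<in> rat_adjoin x" "x * u \<in> rat_adjoin x"
      using mem[of f] mem[of "[:0, 1:] * f"] by (simp_all add: u_def)
    then have "\<sigma> (of_int a + x * u) = of_int a + b * \<sigma> u"
      using \<sigma> int int_mem x_mem by metis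
    then show ?case using pCons.hyps pCons.IH by (simp add: map_poly_pCons u_def)
  qed
  then show ?thesis by (simp add: \<sigma>_def)
qed

text \<open>Gauss's lemma: the primitive integer polynomial \<open>P\<close> proportional to
  \<open>m\<close> divides a monic integer polynomial over the integers, so its leading coefficient
  is a unit, and the positive factor \<open>c\<close> between \<open>P\<close> and \<open>m\<close>
  is 1.\<close>

lemma minimal_polynomial_algebraic_int:
  fixes x :: "'a::field_char_0"
  assumes "algebraic_int x" "minimal_polynomial x m"
  shows "\<exists>P. m = map_poly of_int P"
proof -
  obtain f where f: "poly (map_poly of_int f) x = 0" "lead_coeff f = 1"
    using assms(1) by (auto simp: algebraic_int_altdef_ipoly)
  have "map_poly of_int f = (map_poly of_rat (map_poly of_int f) :: 'a poly)"
    by (simp add: poly_eq_iff)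
  then have "m dvd map_poly of_int f"
    using minimal_polynomial_dvd[OF assms(2)] f by simp
  then obtain g where g: "map_poly of_int f = m * g" by auto
  obtain c P where cP: "rat_to_normalized_int_poly m = (c, P)" by force
  obtain h where "f = P * smult (content f) h"
    using rat_to_int_factor_explicit[OF g cP] by auto
  then have "lead_coeff P dvd 1" using f(2) by (metis lead_coeff_mult dvd_triv_left)
  then have P: "lead_coeff P = 1 \<or> lead_coeff P = - 1" by auto
  have m: "m = smult c (map_poly of_int P)" and c: "c > 0"
    using rat_to_normalized_int_poly[OF cP] by auto
  have "1 = c * of_int (lead_coeff P)"
  proof -
    have "lead_coeff m = 1" using assms(2) by (simp add: minimal_polynomial_def)
    then show ?thesis using c unfolding m by (simp add: of_int_hom.degree_map_poly_hom)
  qed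
  with P c have "c = 1" by auto
  with m show ?thesis by auto
qed

subsection \<open>Coefficients of cofactors of linear factors\<close>

lemma coeff_monic_poly:
  "coeff (monic_poly n c) k = (if k = n then 1 else if k < n then c k else 0)"
proof -
  have "coeff (monic_poly n c) k = (if n = k then 1 else 0) + (\<Sum>i<n. if i = k then c i else 0)"
    by (simp add: monic_poly_def coeff_sum)
  then show ?thesis by (auto simp: sum.delta')
qed

text \<open>One step of Horner's scheme; \<open>poly_shift k\<close> drops the \<open>k\<close>
  lowest coefficients and divides by the matching power of the variable.\<close>

lemma poly_poly_shift:
  "poly (poly_shift k f) c = coeff f k + c * poly (poly_shift (Suc k) f) c"
proof -
  have "poly_shift k f = pCons (coeff f k) (poly_shift (Suc k) f)"
    by (rule poly_eqI) (auto simp: coeff_poly_shift coeff_pCons split: nat.split)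
  then show ?thesis by simp
qed

text \<open>Synthetic division: the coefficients of the cofactor of a linear factor are the
  intermediate values of Horner's scheme at the root.\<close>

lemma coeff_root_cofactor:
  fixes c :: "'a::comm_ring_1"
  shows "coeff g k = poly (poly_shift (Suc k) ([:-c, 1:] * g)) c"
proof -
  define f where "f = [:-c, 1:] * g"
  \<comment> \<open>Downward induction on the index: the formula descends from \<open>k + n\<close>
    to \<open>k\<close>. It starts beyond both degrees, where the two sides vanish.\<close>
  have "coeff g (k + n) = poly (poly_shift (Suc (k + n)) f) c \<Longrightarrow>
    coeff g k = poly (poly_shift (Suc k) f) c" for n
  proof (induction n)
    case (Suc n)
    have "coeff f (Suc (k + n)) = coeff g (k + n) - c * coeff g (k + Suc n)"
      by (simp add: f_def)
    then show ?case using Suc poly_poly_shift[of "Suc (k + n)" f c] by simp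
  qed simp
  moreover have "coeff g (k + Suc (degree f + degree g)) = poly (poly_shift (Suc (k + Suc (degree f + degree g))) f) c"
  proof -
    have "poly_shift (Suc (k + Suc (degree f + degree g))) f = 0"
      by (rule poly_eqI) (simp add: coeff_poly_shift coeff_eq_0)
    then show ?thesis by (simp add: coeff_eq_0)
  qed
  ultimately show ?thesis unfolding f_def by blast
qed

lemma sum_poly_shift_eq_0:
  fixes f :: "'a::idom poly"
  assumes "(\<Sum>k<degree f. smult (v k) (poly_shift (Suc k) f)) = 0" "k < degree f"
  shows "v k = 0"
  \<comment> \<open>the shifts have the pairwise different degrees \<^term>\<open>degree f - Suc k\<close>\<close>
  using assms(2)
proof (induction k rule: less_induct)
  case (less k)
  let ?n = "degree f - Suc k"
  have "f \<noteq> 0" using less.prems by auto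
  have "0 = coeff (\<Sum>k<degree f. smult (v k) (poly_shift (Suc k) f)) ?n"
    using assms(1) by simp
  also have "\<dots> = (\<Sum>j<degree f. v j * coeff f (?n + Suc j))"
    by (simp add: coeff_sum coeff_poly_shift)
  also have "\<dots> = (\<Sum>j<degree f. if j = k then v k * lead_coeff f else 0)"
  proof (rule sum.cong[OF refl])
    fix j assume "j \<in> {..<degree f}"
    show "v j * coeff f (?n + Suc j) = (if j = k then v k * lead_coeff f else 0)"
    proof (cases j k rule: linorder_cases)
      case less': less
      then show ?thesis using less by simp
    next
      case equal
      then show ?thesis using less.prems by simp
    next
      case greater
      then show ?thesis using less.prems by (simp add: coeff_eq_0)
    qed
  qed
  also have "\<dots> = v k * lead_coeff f" using less.prems by simp
  finally show ?case using \<open>f \<noteq> 0\<close> by simp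
qed

text \<open>Each shift loses at least one degree. The strict bound lets divisibility or a count of
  roots force such a combination to be zero.\<close>

lemma degree_sum_poly_shift_less:
  fixes f :: "'a::idom poly"
  assumes "degree f > 0"
  shows "degree (\<Sum>k<degree f. smult (v k) (poly_shift (Suc k) f)) < degree f"
  by (rule degree_lessI) (use assms in \<open>auto simp: coeff_sum coeff_poly_shift coeff_eq_0\<close>)

subsection \<open>Lower limits and linear maps\<close>

text \<open>The Euclidean and the maximum distance bound each other up to a constant depending on
  \<open>d\<close>. The coordinatewise form fits \<open>real_coord\<close>, where each coordinate is
  estimated separately.\<close>

lemma lower_hausdorff_limit_iff:
  "t \<in> lower_hausdorff_limit d A \<longleftrightarrow> t \<in> carrier_vec d \<and>
    (\<forall>\<epsilon>>0. \<forall>\<^sub>F n in sequentially. \<exists>a\<in>A n. a \<in> carrier_vec d \<and> (\<forall>i<d. \<bar>a $ i - t $ i\<bar> < \<epsilon>))"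
  (is "_ \<longleftrightarrow> _ \<and> ?R")
proof -
  have 1: "\<bar>a $ i - t $ i\<bar> < \<epsilon>" if "sqrt (\<Sum>i<d. (a $ i - t $ i)\<^sup>2) < \<epsilon>" "i < d" for \<epsilon> a i
    using member_le_L2_set[of "{..<d}" i "\<lambda>i. \<bar>a $ i - t $ i\<bar>"] that by (simp add: L2_set_def)
  \<comment> \<open>Dividing by \<open>d + 1\<close> instead of \<open>d\<close> makes the final
    inequality strict and also covers \<open>d = 0\<close>.\<close>
  have 2: "sqrt (\<Sum>i<d. (a $ i - t $ i)\<^sup>2) < \<epsilon>"
    if "\<forall>i<d. \<bar>a $ i - t $ i\<bar> < \<epsilon> / (d + 1)" "\<epsilon> > 0" for \<epsilon> a
  proof -
    have "sqrt (\<Sum>i<d. (a $ i - t $ i)\<^sup>2) \<le> (\<Sum>i<d. \<bar>a $ i - t $ i\<bar>)"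
      using L2_set_le_sum_abs[of "\<lambda>i. a $ i - t $ i" "{..<d}"] by (simp add: L2_set_def)
    also have "\<dots> \<le> (\<Sum>i<d. \<epsilon> / (d + 1))"
      using that by (intro sum_mono) (auto simp: less_imp_le)
    also have "\<dots> < \<epsilon>" using that(2) by (simp add: field_simps)
    finally show ?thesis .
  qed
  have "(\<forall>\<epsilon>>0. \<exists>N. \<forall>n\<ge>N. \<exists>a\<in>A n. a \<in> carrier_vec d \<and> sqrt (\<Sum>i<d. (a $ i - t $ i)\<^sup>2) < \<epsilon>) \<longleftrightarrow> ?R"
    (is "?L \<longleftrightarrow> _")
  proof
    assume ?L
    then show ?R unfolding eventually_sequentially using 1 by meson
  next
    assume R: ?R
    show ?L
    proof (intro allI impI)
      fix \<epsilon> :: real assume "\<epsilon> > 0"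
      then have "\<epsilon> / (d + 1) > 0" by simp
      with R obtain N where
        "\<forall>n\<ge>N. \<exists>a\<in>A n. a \<in> carrier_vec d \<and> (\<forall>i<d. \<bar>a $ i - t $ i\<bar> < \<epsilon> / (d + 1))"
        unfolding eventually_sequentially by blast
      then show "\<exists>N. \<forall>n\<ge>N. \<exists>a\<in>A n. a \<in> carrier_vec d \<and> sqrt (\<Sum>i<d. (a $ i - t $ i)\<^sup>2) < \<epsilon>"
        using 2[OF _ \<open>\<epsilon> > 0\<close>] by blast
    qed
  qed
  then show ?thesis unfolding lower_hausdorff_limit_def by simp
qed

lemma index_mult_mat_vec_sum:
  assumes "L \<in> carrier_mat n k" "v \<in> carrier_vec k" "i < n"
  shows "(L *\<^sub>v v) $ i = (\<Sum>j<k. L $$ (i, j) * v $ j)"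
  using assms by (auto simp: scalar_prod_def lessThan_atLeast0)

lemma mult_mat_vec_bound:
  fixes L :: "real mat"
  assumes L: "L \<in> carrier_mat n k"
  obtains C where "C > 0"
    "\<And>v \<delta> i. v \<in> carrier_vec k \<Longrightarrow> \<delta> \<ge> 0 \<Longrightarrow> \<forall>j<k. \<bar>v $ j\<bar> \<le> \<delta> \<Longrightarrow> i < n \<Longrightarrow> \<bar>(L *\<^sub>v v) $ i\<bar> \<le> C * \<delta>"
proof
  \<comment> \<open>The summand 1 keeps \<open>C\<close> positive even for the zero matrix, so that
    it can be divided by later.\<close>
  define C where "C = 1 + (\<Sum>i<n. \<Sum>j<k. \<bar>L $$ (i, j)\<bar>)"
  show "C > 0" unfolding C_def by (simp add: add_pos_nonneg sum_nonneg)
  fix v :: "real vec" and \<delta> :: real and i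
  assume v: "v \<in> carrier_vec k" "\<delta> \<ge> 0" "\<forall>j<k. \<bar>v $ j\<bar> \<le> \<delta>" and i: "i < n"
  have "\<bar>(L *\<^sub>v v) $ i\<bar> \<le> (\<Sum>j<k. \<bar>L $$ (i, j) * v $ j\<bar>)"
    unfolding index_mult_mat_vec_sum[OF L v(1) i] by (rule sum_abs)
  also have "\<dots> \<le> (\<Sum>j<k. \<bar>L $$ (i, j)\<bar> * \<delta>)"
    using v by (intro sum_mono) (auto simp: abs_mult intro!: mult_left_mono)
  also have "\<dots> = (\<Sum>j<k. \<bar>L $$ (i, j)\<bar>) * \<delta>" by (simp add: sum_distrib_right)
  also have "\<dots> \<le> C * \<delta>"
  proof (rule mult_right_mono[OF _ v(2)])
    have "(\<Sum>j<k. \<bar>L $$ (i, j)\<bar>) \<le> (\<Sum>i<n. \<Sum>j<k. \<bar>L $$ (i, j)\<bar>)"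
      by (rule member_le_sum) (use i in \<open>auto intro: sum_nonneg\<close>)
    then show "(\<Sum>j<k. \<bar>L $$ (i, j)\<bar>) \<le> C" by (simp add: C_def)
  qed
  finally show "\<bar>(L *\<^sub>v v) $ i\<bar> \<le> C * \<delta>" .
qed

text \<open>Continuity of \<open>L\<close> with a perturbation: the error \<open>e n\<close> does
  not depend on \<open>z\<close>, so the point of \<open>Z n\<close> that approximates
  \<open>t\<close> also serves for \<open>L *\<^sub>v t\<close>.\<close>

lemma lower_hausdorff_limit_linear_image:
  fixes L :: "real mat"
  assumes L: "L \<in> carrier_mat d d"
    and g: "\<And>n z. z \<in> Z n \<Longrightarrow> g n z \<in> carrier_vec d"
    and f: "\<And>n z. z \<in> Z n \<Longrightarrow> f n z \<in> carrier_vec d"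
    and e: "e \<longlonglongrightarrow> 0"
    and fg: "\<And>n z i. z \<in> Z n \<Longrightarrow> i < d \<Longrightarrow> \<bar>f n z $ i - (L *\<^sub>v g n z) $ i\<bar> \<le> e n"
    and t: "t \<in> lower_hausdorff_limit d (\<lambda>n. g n ` Z n)"
  shows "L *\<^sub>v t \<in> lower_hausdorff_limit d (\<lambda>n. f n ` Z n)"
  unfolding lower_hausdorff_limit_iff
proof (intro conjI allI impI)
  have t': "t \<in> carrier_vec d" using t by (simp add: lower_hausdorff_limit_iff)
  have approx: "\<forall>\<^sub>F n in sequentially. \<exists>z\<in>Z n. \<forall>i<d. \<bar>g n z $ i - t $ i\<bar> < \<epsilon>" if "\<epsilon> > 0" for \<epsilon>
  proof -
    have "\<forall>\<^sub>F n in sequentially. \<exists>a\<in>g n ` Z n. a \<in> carrier_vec d \<and> (\<forall>i<d. \<bar>a $ i - t $ i\<bar> < \<epsilon>)"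
      using t that unfolding lower_hausdorff_limit_iff by blast
    then show ?thesis by (rule eventually_mono) blast
  qed
  show "L *\<^sub>v t \<in> carrier_vec d" using mult_mat_vec_carrier[OF L t'] .
  obtain C where C: "C > 0"
    "\<And>v \<delta> i. v \<in> carrier_vec d \<Longrightarrow> \<delta> \<ge> 0 \<Longrightarrow> \<forall>j<d. \<bar>v $ j\<bar> \<le> \<delta> \<Longrightarrow> i < d \<Longrightarrow> \<bar>(L *\<^sub>v v) $ i\<bar> \<le> C * \<delta>"
    using mult_mat_vec_bound[OF L] by metis
  fix \<epsilon> :: real assume "\<epsilon> > 0"
  \<comment> \<open>\<open>L\<close> turns a deviation of \<delta> into at most half of \<epsilon>;
    the other half is left for \<open>e n\<close>.\<close>
  define \<delta> where "\<delta> = \<epsilon> / (2 * C)"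
  have "\<delta> > 0" using \<open>\<epsilon> > 0\<close> C(1) by (simp add: \<delta>_def)
  have "\<forall>\<^sub>F n in sequentially. e n < \<epsilon> / 2"
    using e by (rule order_tendstoD) (use \<open>\<epsilon> > 0\<close> in simp)
  then show "\<forall>\<^sub>F n in sequentially. \<exists>a\<in>f n ` Z n. a \<in> carrier_vec d \<and> (\<forall>i<d. \<bar>a $ i - (L *\<^sub>v t) $ i\<bar> < \<epsilon>)"
    using approx[OF \<open>\<delta> > 0\<close>]
  proof eventually_elim
    case (elim n)
    then obtain z where z: "z \<in> Z n" "\<forall>i<d. \<bar>g n z $ i - t $ i\<bar> < \<delta>" by blast
    have "\<bar>f n z $ i - (L *\<^sub>v t) $ i\<bar> < \<epsilon>" if "i < d" for i
    proof -
      have "L *\<^sub>v (g n z - t) = L *\<^sub>v g n z - L *\<^sub>v t"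
        using mult_minus_distrib_mat_vec[OF L g[OF z(1)] t'] .
      then have "(L *\<^sub>v g n z) $ i - (L *\<^sub>v t) $ i = (L *\<^sub>v (g n z - t)) $ i"
        using L that by simp
      also have "\<bar>\<dots>\<bar> \<le> C * \<delta>"
        by (rule C(2)) (use z g t' \<open>\<delta> > 0\<close> that in \<open>auto simp: less_imp_le\<close>)
      also have "\<dots> = \<epsilon> / 2" using C(1) by (simp add: \<delta>_def)
      finally show ?thesis using fg[OF z(1) that] elim(1) by linarith
    qed
    then show ?case using f z(1) by blast
  qed
qed

text \<open>The one-sided version is applied to \<open>L\<close> and to its inverse; the inverse
  enlarges the error by a constant factor only.\<close>

lemma lower_hausdorff_limit_linear_image_eq:
  fixes L :: "real mat"
  assumes L: "L \<in> carrier_mat d d" "det L \<noteq> 0"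
    and g: "\<And>n z. z \<in> Z n \<Longrightarrow> g n z \<in> carrier_vec d"
    and f: "\<And>n z. z \<in> Z n \<Longrightarrow> f n z \<in> carrier_vec d"
    and e: "e \<longlonglongrightarrow> 0"
    and fg: "\<And>n z i. z \<in> Z n \<Longrightarrow> i < d \<Longrightarrow> \<bar>f n z $ i - (L *\<^sub>v g n z) $ i\<bar> \<le> e n"
    and e_nonneg: "\<And>n. e n \<ge> 0"
  shows "lower_hausdorff_limit d (\<lambda>n. f n ` Z n) = (\<lambda>t. L *\<^sub>v t) ` lower_hausdorff_limit d (\<lambda>n. g n ` Z n)"
proof
  obtain L' where L': "L' \<in> carrier_mat d d" "L' * L = 1\<^sub>m d" "L * L' = 1\<^sub>m d"
    using det_non_zero_imp_unit[OF L, of "()"] by (auto simp: Units_def ring_mat_simps)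
  obtain C where C: "C > 0"
    "\<And>v \<delta> i. v \<in> carrier_vec d \<Longrightarrow> \<delta> \<ge> 0 \<Longrightarrow> \<forall>j<d. \<bar>v $ j\<bar> \<le> \<delta> \<Longrightarrow> i < d \<Longrightarrow> \<bar>(L' *\<^sub>v v) $ i\<bar> \<le> C * \<delta>"
    using mult_mat_vec_bound[OF L'(1)] by metis
  have gf: "\<bar>g n z $ i - (L' *\<^sub>v f n z) $ i\<bar> \<le> C * e n" if z: "z \<in> Z n" and i: "i < d" for n z i
  proof -
    have Lg: "L *\<^sub>v g n z \<in> carrier_vec d" using mult_mat_vec_carrier[OF L(1) g[OF z]] .
    have "L' *\<^sub>v (L *\<^sub>v g n z) = g n z"
      using assoc_mult_mat_vec[OF L'(1) L(1) g[OF z]] L'(2) g[OF z] by simp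
    then have "L' *\<^sub>v (f n z - L *\<^sub>v g n z) = L' *\<^sub>v f n z - g n z"
      using mult_minus_distrib_mat_vec[OF L'(1) f[OF z] Lg] by simp
    then have "(L' *\<^sub>v f n z) $ i - g n z $ i = (L' *\<^sub>v (f n z - L *\<^sub>v g n z)) $ i"
      using i g[OF z] by simp
    also have "\<bar>\<dots>\<bar> \<le> C * e n"
      by (rule C(2)) (use L(1) f[OF z] Lg fg[OF z] i e_nonneg in auto)
    finally show ?thesis by linarith
  qed
  have Ce: "(\<lambda>n. C * e n) \<longlonglongrightarrow> 0" using tendsto_mult_right_zero[OF e] .
  show "lower_hausdorff_limit d (\<lambda>n. f n ` Z n) \<subseteq> (\<lambda>t. L *\<^sub>v t) ` lower_hausdorff_limit d (\<lambda>n. g n ` Z n)"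
  proof
    fix t assume t: "t \<in> lower_hausdorff_limit d (\<lambda>n. f n ` Z n)"
    then have "t \<in> carrier_vec d" by (simp add: lower_hausdorff_limit_def)
    then have "L *\<^sub>v (L' *\<^sub>v t) = t"
      using assoc_mult_mat_vec[OF L(1) L'(1), of t] L'(3) by simp
    moreover have "L' *\<^sub>v t \<in> lower_hausdorff_limit d (\<lambda>n. g n ` Z n)"
      by (rule lower_hausdorff_limit_linear_image[OF L'(1) f g Ce gf t])
    ultimately show "t \<in> (\<lambda>t. L *\<^sub>v t) ` lower_hausdorff_limit d (\<lambda>n. g n ` Z n)"
      by (metis image_eqI)
  qed
  show "(\<lambda>t. L *\<^sub>v t) ` lower_hausdorff_limit d (\<lambda>n. g n ` Z n) \<subseteq> lower_hausdorff_limit d (\<lambda>n. f n ` Z n)"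
    by (intro image_subsetI lower_hausdorff_limit_linear_image[OF L(1) g f e fg])
qed

subsection \<open>Shift radix systems and beta-transformations\<close>

lemma degree_monic_poly: "degree (monic_poly n (c :: nat \<Rightarrow> 'a::comm_ring_1)) = n"
  by (rule antisym[OF degree_le le_degree]) (simp_all add: coeff_monic_poly)

lemma coeff_linear_mult:
  "coeff ([:- c, 1:] * f) k = (if k = 0 then 0 else coeff f (k - 1)) - c * coeff f k"
  for c :: "'a::comm_ring_1"
  by (cases k) simp_all

text \<open>Every coordinate is the real or imaginary part of one entry with index at most
  \<open>p + s\<close>, one representative per complex pair. Estimates on these entries therefore
  suffice.\<close>

lemma real_coord_cases:
  assumes "i < p + 2 * s"
  obtains j where "j \<in> {1..p + s}" "\<And>w. real_coord p w i = Re (w j)"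
  | j where "j \<in> {1..p + s}" "\<And>w. real_coord p w i = Im (w j)"
proof (cases "i < p")
  case True
  then show ?thesis using that(1)[of "i + 1"] by (simp add: real_coord_def)
next
  case False
  then have "p + 1 + (i - p) div 2 \<in> {1..p + s}" using assms by auto
  then show ?thesis using that[of "p + 1 + (i - p) div 2"] False
    by (cases "even (i - p)") (simp_all add: real_coord_def)
qed

text \<open>Entries up to \<open>p\<close> must be known to be real, because
  \<open>real_coord\<close> keeps only their real parts.\<close>

lemma real_coord_eq_0D:
  assumes 0: "\<And>i. i < p + 2 * s \<Longrightarrow> real_coord p w i = 0"
    and j: "j \<in> {1..p + s}" and real: "j \<le> p \<Longrightarrow> w j \<in> \<real>"
  shows "w j = 0"
proof (cases "j \<le> p")
  case True
  then have "j - 1 < p + 2 * s" "real_coord p w (j - 1) = Re (w j)"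
    using j by (auto simp: real_coord_def)
  then show ?thesis using 0[of "j - 1"] real[OF True]
    by (simp add: complex_is_Real_iff complex_eq_iff)
next
  case False
  define k where "k = j - p - 1"
  have "k < s" "j = p + 1 + k" using False j by (auto simp: k_def)
  then show ?thesis using 0[of "p + 2 * k"] 0[of "p + 2 * k + 1"]
    by (auto simp: real_coord_def complex_eq_iff)
qed

text \<open>\<open>P\<close> is the minimal polynomial of \<beta> as an integer polynomial. Its
  integrality gives the carries in the multiplication by \<beta>, its irreducibility the uniqueness
  of representations in Z[\<beta>].\<close>

locale beta_srs =
  fixes d :: nat and \<beta> :: real and P :: "int poly" and r :: "real vec"
  assumes d_pos: "d \<ge> 1"
    and r_carrier: "r \<in> carrier_vec d"
    and factor: "map_poly of_int P = [:- \<beta>, 1:] * monic_poly d (\<lambda>i. r $ i)"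
    and irred: "irreducible (map_poly of_int P :: rat poly)"
begin

section \<open>Residues and the conjugacy of the shift radix map with the
  \<beta>-transformation\<close>

definition residue :: "int vec \<Rightarrow> real" where
  "residue z = frac (r \<bullet> map_vec of_int z)"

text \<open>The shifts of \<open>P\<close> take the values \<open>r $ k\<close> at \<beta>, so this
  integer polynomial represents \<open>residue z\<close> as an element of Z[\<beta>] and can be
  evaluated at the conjugates as well.\<close>

definition residue_poly :: "int vec \<Rightarrow> int poly" where
  "residue_poly z = (\<Sum>k<d. smult (z $ k) (poly_shift (Suc k) P)) - [:\<lfloor>r \<bullet> map_vec of_int z\<rfloor>:]"

lemma degree_P: "degree P = Suc d"
proof -
  have "monic_poly d (\<lambda>i. r $ i) \<noteq> 0"
    using coeff_monic_poly[of d "\<lambda>i. r $ i" d] by auto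
  then have "degree (map_poly of_int P :: real poly) = Suc d"
    unfolding factor by (subst degree_mult_eq) (simp_all add: degree_monic_poly)
  then show ?thesis by simp
qed

lemma map_poly_P: "map_poly of_rat (map_poly of_int P) = (map_poly of_int P :: 'a::field_char_0 poly)"
  by (simp add: poly_eq_iff)

lemma beta_root: "poly (map_poly of_int P) \<beta> = 0"
  unfolding factor by simp

lemma beta_root_rat: "poly (map_poly of_rat (map_poly of_int P)) \<beta> = 0"
  by (simp only: map_poly_P beta_root)

lemma poly_shift_beta: "k \<le> d \<Longrightarrow> poly (poly_shift (Suc k) (map_poly of_int P)) \<beta> = (if k = d then 1 else r $ k)"
  using coeff_root_cofactor[of "monic_poly d (\<lambda>i. r $ i)" k \<beta>]
  by (auto simp: factor coeff_monic_poly)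

lemma scalar_prod_r: "v \<in> carrier_vec d \<Longrightarrow> r \<bullet> v = (\<Sum>k<d. r $ k * v $ k)"
  by (simp add: scalar_prod_def lessThan_atLeast0)

text \<open>Comparing coefficients in \<open>factor\<close> shows that \<beta> times a coefficient
  of the cofactor is the preceding coefficient minus an integer. Multiplication by \<beta> thus
  shifts the coordinates, and the coefficients of \<open>P\<close> are collected in
  \<open>N\<close>.\<close>

lemma beta_mult:
  assumes z: "z \<in> carrier_vec d"
  shows "\<exists>N. \<beta> * (r \<bullet> map_vec of_int z + of_int n) =
    r \<bullet> map_vec of_int (vec d (\<lambda>i. if i + 1 < d then z $ (i + 1) else n)) + of_int N"
proof -
  define R where "R = monic_poly d (\<lambda>i. r $ i)"
  \<comment> \<open>\<open>w\<close> appends \<open>n\<close> to \<open>z\<close>; the leading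
    coefficient 1 of \<open>R\<close> carries this integer term.\<close>
  define w where "w k = (if k < d then z $ k else n)" for k
  have R: "coeff R k = (if k = d then 1 else if k < d then r $ k else 0)" for k
    by (simp add: R_def coeff_monic_poly)
  have "coeff (map_poly of_int P) k = (if k = 0 then 0 else coeff R (k - 1)) - \<beta> * coeff R k" for k
    unfolding factor R_def[symmetric] by (rule coeff_linear_mult)
  then have rec: "\<beta> * coeff R k = (if k = 0 then 0 else coeff R (k - 1)) - of_int (coeff P k)" for k
    by (simp add: algebra_simps)
  have "r \<bullet> map_vec of_int z + of_int n = (\<Sum>k<d. coeff R k * of_int (w k)) + of_int (w d)"
    using z by (auto simp: scalar_prod_r R w_def)
  also have "\<dots> = (\<Sum>k<Suc d. coeff R k * of_int (w k))" by (simp add: R)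
  also have "\<beta> * \<dots> = (\<Sum>k<Suc d. \<beta> * coeff R k * of_int (w k))"
    by (simp only: sum_distrib_left mult.assoc)
  also have "\<dots> = (\<Sum>k<Suc d. (if k = 0 then 0 else coeff R (k - 1)) * of_int (w k))
      + of_int (- (\<Sum>k<Suc d. coeff P k * w k))"
    unfolding rec by (simp only: left_diff_distrib sum_subtractf of_int_minus of_int_sum of_int_mult)
  also have "(\<Sum>k<Suc d. (if k = 0 then 0 else coeff R (k - 1)) * of_int (w k)) =
      (\<Sum>k<d. coeff R k * of_int (w (Suc k)))"
    by (subst sum.lessThan_Suc_shift) simp
  also have "\<dots> = r \<bullet> map_vec of_int (vec d (\<lambda>i. if i + 1 < d then z $ (i + 1) else n))"
    by (subst scalar_prod_r) (auto simp: R w_def intro!: sum.cong)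
  finally show ?thesis by blast
qed

lemma srs_map_carrier: "srs_map r z \<in> carrier_vec d"
  using r_carrier by (auto simp: srs_map_def)

text \<open>With \<open>n\<close> the negated floor, the shifted vector in \<open>beta_mult\<close>
  is exactly the image under \<open>srs_map\<close>, and the fractional part discards the integer
  \<open>N\<close>.\<close>

lemma residue_srs_map:
  assumes z: "z \<in> carrier_vec d"
  shows "residue (srs_map r z) = beta_map \<beta> (residue z)"
proof -
  define n where "n = - \<lfloor>r \<bullet> map_vec of_int z\<rfloor>"
  have "srs_map r z = vec d (\<lambda>i. if i + 1 < d then z $ (i + 1) else n)"
    using r_carrier by (auto simp: srs_map_def n_def)
  moreover have "residue z = r \<bullet> map_vec of_int z + of_int n"
    by (simp add: residue_def n_def frac_def)
  ultimately obtain N where N: "\<beta> * residue z = r \<bullet> map_vec of_int (srs_map r z) + of_int N"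
    using beta_mult[OF z, of n] by auto
  show ?thesis unfolding beta_map_def N residue_def[of "srs_map r z"] by (simp add: frac_def)
qed

lemma residue_srs_map_pow:
  assumes z: "z \<in> carrier_vec d"
  shows "(srs_map r ^^ n) z \<in> carrier_vec d \<and>
    residue ((srs_map r ^^ n) z) = (beta_map \<beta> ^^ n) (residue z)"
  by (induction n) (use z residue_srs_map srs_map_carrier in auto)

lemma poly_residue_poly:
  fixes c :: "'a::{comm_ring_1,ring_char_0}"
  shows "poly (map_poly of_int (residue_poly z)) c =
    (\<Sum>k<d. of_int (z $ k) * poly (poly_shift (Suc k) (map_poly of_int P)) c) - of_int \<lfloor>r \<bullet> map_vec of_int z\<rfloor>"
proof -
  have "map_poly of_int (residue_poly z) = (\<Sum>k<d. smult (of_int (z $ k)) (poly_shift (Suc k) (map_poly of_int P)))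
      - ([:of_int \<lfloor>r \<bullet> map_vec of_int z\<rfloor>:] :: 'a poly)"
    by (rule poly_eqI) (simp add: residue_poly_def coeff_sum coeff_poly_shift coeff_pCons split: nat.split)
  then show ?thesis by (simp add: poly_sum)
qed

lemma residue_eq_poly:
  assumes "z \<in> carrier_vec d"
  shows "residue z = poly (map_poly of_int (residue_poly z)) \<beta>"
  unfolding poly_residue_poly residue_def frac_def
  using assms by (auto simp: scalar_prod_r poly_shift_beta mult.commute intro!: sum.cong)

text \<open>The integer combinations of 1 and the entries of \<open>r\<close> are closed under
  multiplication by \<beta>, so Horner's scheme never leaves them.\<close>

lemma int_adjoin_representation:
  assumes "y \<in> int_adjoin \<beta>"
  shows "\<exists>z\<in>carrier_vec d. \<exists>n. y = r \<bullet> map_vec of_int z + of_int n"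
proof -
  have "\<exists>z\<in>carrier_vec d. \<exists>n. poly (map_poly of_int f) \<beta> = r \<bullet> map_vec of_int z + of_int n" for f
  proof (induction f)
    case 0
    have "r \<bullet> map_vec of_int (0\<^sub>v d) = 0" by (simp add: scalar_prod_r)
    then show ?case by (intro bexI[of _ "0\<^sub>v d"] exI[of _ 0]) auto
  next
    case (pCons a f)
    then obtain z n where z: "z \<in> carrier_vec d"
      and f: "poly (map_poly of_int f) \<beta> = r \<bullet> map_vec of_int z + of_int n" by blast
    define z' where "z' = vec d (\<lambda>i. if i + 1 < d then z $ (i + 1) else n)"
    obtain N where "\<beta> * (r \<bullet> map_vec of_int z + of_int n) = r \<bullet> map_vec of_int z' + of_int N"
      using beta_mult[OF z, of n] unfolding z'_def by blast
    then have "poly (map_poly of_int (pCons a f)) \<beta> = r \<bullet> map_vec of_int z' + of_int (a + N)"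
      using pCons.hyps by (simp add: map_poly_pCons f)
    moreover have "z' \<in> carrier_vec d" by (simp add: z'_def)
    ultimately show ?case by blast
  qed
  then show ?thesis using assms by (auto simp: int_adjoin_def)
qed

text \<open>Equal residues give an integer combination of shifts of \<open>P\<close> that vanishes
  at \<beta>. Its degree is below that of the irreducible \<open>P\<close>, so it is zero, and the
  shifts are linearly independent.\<close>

lemma residue_inj:
  assumes z: "z \<in> carrier_vec d" and z': "z' \<in> carrier_vec d" and eq: "residue z = residue z'"
  shows "z = z'"
proof -
  define n where "n = \<lfloor>r \<bullet> map_vec of_int z\<rfloor> - \<lfloor>r \<bullet> map_vec of_int z'\<rfloor>"
  \<comment> \<open>The difference of the floors goes to index \<open>d\<close>, whose shift of
    \<open>P\<close> is the constant 1.\<close>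
  define v where "v k = (if k < d then z $ k - z' $ k else - n)" for k
  define G where "G = (\<Sum>k<degree P. smult (v k) (poly_shift (Suc k) P))"
  have "map_poly of_int G = (\<Sum>k<Suc d. smult (of_int (v k)) (poly_shift (Suc k) (map_poly of_int P :: real poly)))"
    by (rule poly_eqI) (simp add: G_def degree_P coeff_sum coeff_poly_shift)
  then have "poly (map_poly of_int G) \<beta> = (\<Sum>k<d. of_int (z $ k - z' $ k) * r $ k) - of_int n"
    by (simp add: poly_sum poly_shift_beta v_def)
  also have "(\<Sum>k<d. of_int (z $ k - z' $ k) * r $ k) = r \<bullet> map_vec of_int z - r \<bullet> map_vec of_int z'"
    using z z' by (simp add: scalar_prod_r algebra_simps sum_subtractf)
  also have "\<dots> - of_int n = residue z - residue z'" by (simp add: residue_def frac_def n_def)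
  finally have root: "poly (map_poly of_int G) \<beta> = 0" using eq by simp
  have "G = 0"
  proof (rule ccontr)
    assume "G \<noteq> 0"
    have "map_poly of_rat (map_poly of_int G) = (map_poly of_int G :: real poly)"
      by (simp add: poly_eq_iff)
    then have "map_poly of_int P dvd (map_poly of_int G :: rat poly)"
      using irreducible_root_iff_dvd[OF irred beta_root_rat, of "map_poly of_int G"] root
      by simp
    then have "degree (map_poly of_int P :: rat poly) \<le> degree (map_poly of_int G :: rat poly)"
      by (rule dvd_imp_degree_le) (use \<open>G \<noteq> 0\<close> in simp)
    then have "degree P \<le> degree G" by simp
    moreover have "degree G < degree P"
      unfolding G_def by (rule degree_sum_poly_shift_less) (simp add: degree_P)
    ultimately show False by simp
  qed
  then have "v k = 0" if "k < d" for k
    using sum_poly_shift_eq_0[of v P k] that by (simp add: G_def degree_P)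
  then show ?thesis using z z' by (intro eq_vecI) (auto simp: v_def)
qed

text \<open>Representability in Z[\<beta>] supplies a vector for each preimage, and injectivity of
  \<open>residue\<close> turns an equality of residues after \<open>n\<close> steps into one of
  vectors.\<close>

lemma beta_preimage_residue:
  assumes x: "x \<in> carrier_vec d"
  shows "beta_preimage \<beta> n (residue x) \<inter> int_adjoin \<beta> = residue ` srs_preimage r n x"
proof
  show "residue ` srs_preimage r n x \<subseteq> beta_preimage \<beta> n (residue x) \<inter> int_adjoin \<beta>"
  proof
    fix y assume "y \<in> residue ` srs_preimage r n x"
    then obtain z where z: "z \<in> carrier_vec d" "(srs_map r ^^ n) z = x" "y = residue z"
      using r_carrier by (auto simp: srs_preimage_def)
    have "y \<in> {0..<1}" by (simp add: z(3) residue_def frac_lt_1)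
    moreover have "y \<in> int_adjoin \<beta>" by (simp add: z residue_eq_poly int_adjoin_def)
    ultimately show "y \<in> beta_preimage \<beta> n (residue x) \<inter> int_adjoin \<beta>"
      using residue_srs_map_pow[OF z(1), of n] z by (simp add: beta_preimage_def)
  qed
  show "beta_preimage \<beta> n (residue x) \<inter> int_adjoin \<beta> \<subseteq> residue ` srs_preimage r n x"
  proof
    fix y assume "y \<in> beta_preimage \<beta> n (residue x) \<inter> int_adjoin \<beta>"
    then have y: "0 \<le> y" "y < 1" "(beta_map \<beta> ^^ n) y = residue x" "y \<in> int_adjoin \<beta>"
      by (auto simp: beta_preimage_def)
    obtain z k where z: "z \<in> carrier_vec d" and k: "y = r \<bullet> map_vec of_int z + of_int k"
      using int_adjoin_representation[OF y(4)] by blast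
    \<comment> \<open>Since \<open>y\<close> lies in the unit interval, passing to the fractional
      part absorbs the integer \<open>k\<close>.\<close>
    have "frac y = y" using y by (simp add: frac_eq)
    then have "y = residue z" unfolding residue_def using k by (simp add: frac_def)
    moreover have "(srs_map r ^^ n) z = x"
      using residue_srs_map_pow[OF z, of n] y(3) \<open>y = residue z\<close> by (intro residue_inj) (auto simp: x)
    ultimately show "y \<in> residue ` srs_preimage r n x"
      using z r_carrier by (auto simp: srs_preimage_def)
  qed
qed

text \<open>The summand \<open>residue z\<close> on the right is the unconjugated real number. It
  becomes the error term, while the sum is the pairing of \<open>z\<close> with the row of cofactor
  coefficients.\<close>

lemma conj_iso_residue:
  assumes z: "z \<in> carrier_vec d"
    and Q: "monic_poly d (\<lambda>i. complex_of_real (r $ i)) = [:- b, 1:] * Q"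
  shows "conj_iso \<beta> b (\<beta> ^ n * residue z) =
    b ^ n * ((b - \<beta>) * (\<Sum>k<d. coeff Q k * of_int (z $ k)) + residue z)"
proof -
  have "map_poly of_int P = map_poly complex_of_real (map_poly of_int P)"
    by (simp add: poly_eq_iff)
  also have "\<dots> = [:- complex_of_real \<beta>, 1:] * monic_poly d (\<lambda>i. complex_of_real (r $ i))"
  proof -
    have "map_poly complex_of_real (monic_poly d (\<lambda>i. r $ i)) = monic_poly d (\<lambda>i. complex_of_real (r $ i))"
      by (simp add: poly_eq_iff coeff_monic_poly)
    moreover have "map_poly complex_of_real [:- \<beta>, 1:] = [:- complex_of_real \<beta>, 1:]" by simp
    ultimately show ?thesis unfolding factor of_real_poly_hom.hom_mult by metis
  qed
  finally have P: "map_poly of_int P = [:- b, 1:] * ([:- complex_of_real \<beta>, 1:] * Q)"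
    unfolding Q by (simp only: mult.left_commute)
  have root: "poly (map_poly of_int P) b = 0" unfolding P by simp
  have r: "complex_of_real (r $ k) = (if k = 0 then 0 else coeff Q (k - 1)) - b * coeff Q k" if "k < d" for k
    using arg_cong[OF Q, of "\<lambda>f. coeff f k"] that by (simp only: coeff_linear_mult) (simp add: coeff_monic_poly)
  \<comment> \<open>Dividing \<open>P\<close> by the linear factor of \<open>b\<close> leaves the
    product of \<open>Q\<close> with the linear factor of \<beta>. Its coefficient is rewritten with
    the corresponding relation \<open>r\<close> for the factorization at \<open>b\<close>.\<close>
  have shift: "poly (poly_shift (Suc k) (map_poly of_int P)) b = (b - \<beta>) * coeff Q k + r $ k" if "k < d" for k
  proof -
    have "poly (poly_shift (Suc k) (map_poly of_int P)) b = coeff ([:- complex_of_real \<beta>, 1:] * Q) k"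
      unfolding P by (rule coeff_root_cofactor[symmetric])
    then show ?thesis unfolding r[OF that] coeff_linear_mult by (simp add: algebra_simps)
  qed
  have "poly (map_poly of_int (residue_poly z)) b =
      (\<Sum>k<d. of_int (z $ k) * ((b - \<beta>) * coeff Q k + r $ k)) - of_int \<lfloor>r \<bullet> map_vec of_int z\<rfloor>"
    unfolding poly_residue_poly by (simp add: shift)
  also have "\<dots> = (b - \<beta>) * (\<Sum>k<d. coeff Q k * of_int (z $ k))
      + ((\<Sum>k<d. of_int (z $ k) * complex_of_real (r $ k)) - of_int \<lfloor>r \<bullet> map_vec of_int z\<rfloor>)"
    by (simp add: algebra_simps sum.distrib sum_distrib_left sum_subtractf)
  also have "(\<Sum>k<d. of_int (z $ k) * complex_of_real (r $ k)) - of_int \<lfloor>r \<bullet> map_vec of_int z\<rfloor> = residue z"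
    using z by (simp add: residue_def frac_def scalar_prod_r mult.commute)
  finally have val: "poly (map_poly of_int (residue_poly z)) b =
      (b - \<beta>) * (\<Sum>k<d. coeff Q k * of_int (z $ k)) + residue z" .
  have "\<beta> ^ n * residue z = poly (map_poly of_int (monom 1 n * residue_poly z)) \<beta>"
    unfolding of_int_poly_hom.hom_mult residue_eq_poly[OF z] by (simp add: poly_monom)
  also have "conj_iso \<beta> b \<dots> = poly (map_poly of_int (monom 1 n * residue_poly z)) b"
    by (rule conj_iso_int_poly[OF irred]) (simp_all add: map_poly_P beta_root root)
  also have "\<dots> = b ^ n * poly (map_poly of_int (residue_poly z)) b"
    unfolding of_int_poly_hom.hom_mult by (simp add: poly_monom)
  finally show ?thesis unfolding val .
qed

section \<open>Cofactor rows: left eigenvectors of the companion matrix and their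
  independence\<close>

lemma companion_matrix_carrier: "companion_matrix r \<in> carrier_mat d d"
  using r_carrier by (auto simp: companion_matrix_def)

text \<open>Entry \<open>k\<close> of the row times the matrix is
  \<open>coeff Q (k - 1) - r $ k\<close> (without the first term for \<open>k = 0\<close>), because
  the last entry of the row is 1. By the factorization this equals
  \<open>b * coeff Q k\<close>.\<close>

lemma companion_left_eigenvector:
  assumes v: "v \<in> carrier_vec d"
    and Q: "monic_poly d (\<lambda>i. complex_of_real (r $ i)) = [:- b, 1:] * Q" and lead: "coeff Q (d - 1) = 1"
  shows "(\<Sum>k<d. coeff Q k * of_real ((companion_matrix r *\<^sub>v v) $ k)) = b * (\<Sum>k<d. coeff Q k * of_real (v $ k))"
proof -
  obtain e where d: "d = Suc e" using d_pos by (cases d) auto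
  have r: "complex_of_real (r $ k) = (if k = 0 then 0 else coeff Q (k - 1)) - b * coeff Q k" if "k < d" for k
    using arg_cong[OF Q, of "\<lambda>f. coeff f k"] that by (simp only: coeff_linear_mult) (simp add: coeff_monic_poly)
  have M: "(companion_matrix r *\<^sub>v v) $ k = (if k < e then v $ Suc k else - (\<Sum>i<d. r $ i * v $ i))" if "k < d" for k
  proof -
    have "(companion_matrix r *\<^sub>v v) $ k = (\<Sum>i<d. (if k = e then - (r $ i) else if i = Suc k then 1 else 0) * v $ i)"
      using that r_carrier v
      by (auto simp: companion_matrix_def scalar_prod_def lessThan_atLeast0 d intro!: sum.cong)
    also have "\<dots> = (if k < e then v $ Suc k else - (\<Sum>i<d. r $ i * v $ i))"
    proof (cases "k = e")
      case False
      then have "(\<Sum>i<d. (if i = Suc k then 1 else 0) * v $ i) = (\<Sum>i<d. if i = Suc k then v $ i else 0)"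
        by (intro sum.cong) auto
      then show ?thesis using False that by (simp add: d)
    qed (simp add: sum_negf)
    finally show ?thesis .
  qed
  have "(\<Sum>k<d. coeff Q k * of_real ((companion_matrix r *\<^sub>v v) $ k)) =
      (\<Sum>k<e. coeff Q k * of_real (v $ Suc k)) - (\<Sum>i<d. complex_of_real (r $ i) * of_real (v $ i))"
  proof -
    have "(\<Sum>k<d. coeff Q k * of_real ((companion_matrix r *\<^sub>v v) $ k)) =
        (\<Sum>k<e. coeff Q k * of_real ((companion_matrix r *\<^sub>v v) $ k)) + of_real ((companion_matrix r *\<^sub>v v) $ e)"
      using lead by (simp add: d)
    also have "(\<Sum>k<e. coeff Q k * of_real ((companion_matrix r *\<^sub>v v) $ k)) = (\<Sum>k<e. coeff Q k * of_real (v $ Suc k))"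
      by (rule sum.cong) (simp_all add: M d)
    also have "(companion_matrix r *\<^sub>v v) $ e = - (\<Sum>i<d. r $ i * v $ i)" using M[of e] by (simp add: d)
    finally show ?thesis by simp
  qed
  also have "(\<Sum>i<d. complex_of_real (r $ i) * of_real (v $ i)) =
      (\<Sum>i<d. (if i = 0 then 0 else coeff Q (i - 1)) * of_real (v $ i)) - b * (\<Sum>i<d. coeff Q i * of_real (v $ i))"
    by (simp add: r algebra_simps sum_subtractf sum_distrib_left)
  also have "(\<Sum>i<d. (if i = 0 then 0 else coeff Q (i - 1)) * complex_of_real (v $ i)) =
      (\<Sum>k<e. coeff Q k * of_real (v $ Suc k))"
    unfolding d by (subst sum.lessThan_Suc_shift) simp
  finally show ?thesis by simp
qed

text \<open>The eigenvalues of the factors multiply. The result is the main term of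
  \<open>conj_iso_residue\<close>.\<close>

lemma companion_pow_left_eigenvector:
  assumes v: "v \<in> carrier_vec d"
    and Q: "monic_poly d (\<lambda>i. complex_of_real (r $ i)) = [:- b, 1:] * Q" and lead: "coeff Q (d - 1) = 1"
  shows "(\<Sum>k<d. coeff Q k * of_real (((companion_matrix r - \<beta> \<cdot>\<^sub>m 1\<^sub>m d) *\<^sub>v ((companion_matrix r ^\<^sub>m n) *\<^sub>v v)) $ k)) =
    (b - \<beta>) * (b ^ n * (\<Sum>k<d. coeff Q k * of_real (v $ k)))"
proof -
  note M = companion_matrix_carrier
  have pow: "(\<Sum>k<d. coeff Q k * of_real (((companion_matrix r ^\<^sub>m n) *\<^sub>v v) $ k)) =
      b ^ n * (\<Sum>k<d. coeff Q k * of_real (v $ k))"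
    using v
  proof (induction n arbitrary: v)
    case 0
    then show ?case using M by simp
  next
    case (Suc n)
    have "companion_matrix r ^\<^sub>m Suc n *\<^sub>v v = companion_matrix r ^\<^sub>m n *\<^sub>v (companion_matrix r *\<^sub>v v)"
      using assoc_mult_mat_vec[OF pow_carrier_mat[OF M] M Suc.prems] by simp
    moreover have "companion_matrix r *\<^sub>v v \<in> carrier_vec d"
      using mult_mat_vec_carrier[OF M Suc.prems] .
    ultimately show ?case
      by (simp only: Suc.IH companion_left_eigenvector[OF Suc.prems Q lead] power_Suc mult_ac)
  qed
  define w where "w = (companion_matrix r ^\<^sub>m n) *\<^sub>v v"
  have w: "w \<in> carrier_vec d"
    unfolding w_def by (rule mult_mat_vec_carrier[OF pow_carrier_mat[OF M] v])
  have "(companion_matrix r - \<beta> \<cdot>\<^sub>m 1\<^sub>m d) *\<^sub>v w = companion_matrix r *\<^sub>v w - \<beta> \<cdot>\<^sub>v w"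
  proof -
    have "(\<beta> \<cdot>\<^sub>m 1\<^sub>m d) *\<^sub>v w = \<beta> \<cdot>\<^sub>v w"
      by (rule eq_vecI) (use w in auto)
    then show ?thesis using minus_mult_distrib_mat_vec[OF M _ w, of "\<beta> \<cdot>\<^sub>m 1\<^sub>m d"] by simp
  qed
  then have "(\<Sum>k<d. coeff Q k * of_real (((companion_matrix r - \<beta> \<cdot>\<^sub>m 1\<^sub>m d) *\<^sub>v w) $ k)) =
      (\<Sum>k<d. coeff Q k * of_real ((companion_matrix r *\<^sub>v w) $ k)) - \<beta> * (\<Sum>k<d. coeff Q k * of_real (w $ k))"
    using M w by (simp add: algebra_simps sum_subtractf sum_distrib_left)
  also have "\<dots> = (b - \<beta>) * (\<Sum>k<d. coeff Q k * of_real (w $ k))"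
    by (simp add: companion_left_eigenvector[OF w Q lead] algebra_simps)
  finally show ?thesis unfolding w_def pow .
qed

text \<open>One real polynomial whose value at each conjugate is the pairing of \<open>v\<close>
  with the cofactor row of that conjugate. It reduces independence of the rows to a count of
  roots.\<close>

definition cofactor_pairing :: "real vec \<Rightarrow> real poly" where
  "cofactor_pairing v = (\<Sum>k<d. smult (v $ k) (poly_shift (Suc k) (monic_poly d (\<lambda>i. r $ i))))"

lemma poly_cofactor_pairing:
  assumes Q: "monic_poly d (\<lambda>i. complex_of_real (r $ i)) = [:- b, 1:] * Q"
  shows "poly (map_poly of_real (cofactor_pairing v)) b = (\<Sum>k<d. coeff Q k * of_real (v $ k))"
proof -
  have "map_poly of_real (cofactor_pairing v) = (\<Sum>k<d. smult (of_real (v $ k))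
      (poly_shift (Suc k) (monic_poly d (\<lambda>i. complex_of_real (r $ i)))))"
    by (rule poly_eqI)
      (auto simp: cofactor_pairing_def coeff_sum coeff_poly_shift coeff_monic_poly intro!: sum.cong)
  moreover have "coeff Q k = poly (poly_shift (Suc k) (monic_poly d (\<lambda>i. complex_of_real (r $ i)))) b" for k
    unfolding Q by (rule coeff_root_cofactor)
  ultimately show ?thesis by (simp add: poly_sum mult.commute)
qed

text \<open>A polynomial of degree below \<open>d\<close> with \<open>d\<close> distinct roots is
  zero, and the shifts occurring in it are linearly independent.\<close>

lemma cofactor_pairing_eq_0:
  assumes v: "v \<in> carrier_vec d"
    and B: "card B = d" "\<And>b. b \<in> B \<Longrightarrow> poly (map_poly complex_of_real (cofactor_pairing v)) b = 0"
  shows "v = 0\<^sub>v d"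
proof -
  let ?R = "monic_poly d (\<lambda>i. r $ i)"
  have deg: "degree (cofactor_pairing v) < d"
    using degree_sum_poly_shift_less[of ?R "\<lambda>k. v $ k"] d_pos
    by (simp add: degree_monic_poly cofactor_pairing_def)
  have "cofactor_pairing v = 0"
  proof (rule ccontr)
    assume "cofactor_pairing v \<noteq> 0"
    then have nz: "map_poly complex_of_real (cofactor_pairing v) \<noteq> 0" by simp
    have "card B \<le> card {b. poly (map_poly complex_of_real (cofactor_pairing v)) b = 0}"
      by (rule card_mono[OF poly_roots_finite[OF nz]]) (use B(2) in auto)
    also have "\<dots> \<le> degree (cofactor_pairing v)"
      using card_poly_roots_bound[OF nz] by simp
    finally show False using deg B(1) by simp
  qed
  then have "v $ k = 0" if "k < d" for k
    using sum_poly_shift_eq_0[of "\<lambda>k. v $ k" ?R k] that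
    by (simp add: degree_monic_poly cofactor_pairing_def)
  then show ?thesis using v by (intro eq_vecI) auto
qed

end

section \<open>Combination: invertibility of the linear map and the uniform error bound\<close>

theorem theorem6p7:
  fixes d p s :: nat
    and \<beta> :: real
    and m :: "rat poly"
    and r :: "real vec"
    and b :: "nat \<Rightarrow> complex"
    and q :: "nat \<Rightarrow> nat \<Rightarrow> complex"
  assumes "d \<ge> 1"
    and "r \<in> carrier_vec d"
    and "pisot \<beta>"
    and "minimal_polynomial \<beta> m"
    and "map_poly of_rat m = [:- \<beta>, 1:] * monic_poly d (\<lambda>i. r $ i)"
    and "d = p + 2 * s"
    and "bij_betw b {1..d} {z. galois_conjugate \<beta> z \<and> z \<noteq> of_real \<beta>}"
    and "\<forall>j\<in>{1..p}. b j \<in> \<real>"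
    and "\<forall>j\<in>{p+1..p+2*s}. b j \<notin> \<real>"
    and "\<forall>j\<in>{1..s}. b (p + j) = cnj (b (p + s + j))"
    and "\<forall>j\<in>{1..d}. monic_poly d (\<lambda>i. complex_of_real (r $ i))
                       = [:- b j, 1:] * monic_poly (d - 1) (q j)"
  shows "\<forall>x\<in>carrier_vec d.
           integral_beta_tile \<beta> b p s (frac (r \<bullet> map_vec of_int x)) =
           (\<lambda>t. (U_matrix p s q * (companion_matrix r - \<beta> \<cdot>\<^sub>m 1\<^sub>m d)) *\<^sub>v t) ` srs_tile r x"
proof
  fix x :: "int vec" assume x: "x \<in> carrier_vec d"
  obtain P where P: "m = map_poly of_int P"
    using minimal_polynomial_algebraic_int[OF _ assms(4)] assms(3) by (auto simp: pisot_def)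
  have m_real: "map_poly of_rat m = (map_poly of_int P :: real poly)"
    by (simp add: P poly_eq_iff)
  interpret beta_srs d \<beta> P r
    by unfold_locales (use assms m_real minimal_polynomial_irreducible[OF assms(4)] P in simp_all)
  define Q where "Q j = monic_poly (d - 1) (q j)" for j
  have Q: "monic_poly d (\<lambda>i. complex_of_real (r $ i)) = [:- b j, 1:] * Q j" if "j \<in> {1..d}" for j
    using assms(11) that by (simp add: Q_def)
  have lead: "coeff (Q j) (d - 1) = 1" for j by (simp add: Q_def coeff_monic_poly)
  have conj: "galois_conjugate \<beta> (b j)" "b j \<noteq> of_real \<beta>" if "j \<in> {1..d}" for j
    using bij_betwE[OF assms(7)] that by auto
  have b_less_1: "cmod (b j) < 1" if "j \<in> {1..d}" for j
    using assms(3) conj[OF that] by (auto simp: pisot_def)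
  have inj: "inj_on b {1..d}" using assms(7) by (rule bij_betw_imp_inj_on)
  define N where "N = companion_matrix r - \<beta> \<cdot>\<^sub>m 1\<^sub>m d"
  have N: "N \<in> carrier_mat d d" by (simp add: N_def minus_carrier_mat)
  have U: "U_matrix p s q \<in> carrier_mat d d" by (simp add: U_matrix_def assms(6))
  define L where "L = U_matrix p s q * N"
  have L: "L \<in> carrier_mat d d" using U N by (simp add: L_def)
  have L_index: "(L *\<^sub>v v) $ i = real_coord p (\<lambda>j. \<Sum>k<d. coeff (Q j) k * of_real ((N *\<^sub>v v) $ k)) i"
    if v: "v \<in> carrier_vec d" and i: "i < d" for v i
  proof -
    have "(L *\<^sub>v v) $ i = (U_matrix p s q *\<^sub>v (N *\<^sub>v v)) $ i"
      unfolding L_def assoc_mult_mat_vec[OF U N v] ..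
    also have "\<dots> = (\<Sum>k<d. U_matrix p s q $$ (i, k) * (N *\<^sub>v v) $ k)"
      by (rule index_mult_mat_vec_sum[OF U mult_mat_vec_carrier[OF N v] i])
    also have "\<dots> = (\<Sum>k<d. real_coord p (\<lambda>j. coeff (Q j) k) i * (N *\<^sub>v v) $ k)"
    proof (rule sum.cong[OF refl])
      \<comment> \<open>The constant last column of \<open>U_matrix\<close> is the leading
        coefficient of every \<open>Q j\<close>; \<open>real_coord\<close> makes it 1 in the real
        rows and 0 in the imaginary ones.\<close>
      fix k assume "k \<in> {..<d}"
      then have "(\<lambda>j. if k = p + 2 * s - 1 then 1 else q j k) = (\<lambda>j. coeff (Q j) k)"
        by (auto simp: Q_def coeff_monic_poly assms(6) fun_eq_iff)
      then show "U_matrix p s q $$ (i, k) * (N *\<^sub>v v) $ k = real_coord p (\<lambda>j. coeff (Q j) k) i * (N *\<^sub>v v) $ k"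
        using i \<open>k \<in> {..<d}\<close> by (simp add: U_matrix_def assms(6))
    qed
    also have "\<dots> = real_coord p (\<lambda>j. \<Sum>k<d. coeff (Q j) k * of_real ((N *\<^sub>v v) $ k)) i"
      by (rule real_coord_cases[of i p s]) (use i assms(6) in simp_all)
    finally show ?thesis .
  qed
  have pow: "(\<Sum>k<d. coeff (Q j) k * of_real ((N *\<^sub>v (companion_matrix r ^\<^sub>m n *\<^sub>v v)) $ k)) =
      (b j - \<beta>) * (b j ^ n * (\<Sum>k<d. coeff (Q j) k * of_real (v $ k)))"
    if "j \<in> {1..d}" "v \<in> carrier_vec d" for j n v
    unfolding N_def by (rule companion_pow_left_eigenvector[OF that(2) Q[OF that(1)] lead])
  \<comment> \<open>A kernel vector \<open>v\<close> makes the real polynomial \<open>V\<close>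
    vanish at all \<open>d\<close> conjugates. The rows of \<open>U_matrix\<close> give this for
    indices up to \<open>p + s\<close>, and complex conjugation gives the rest.\<close>
  have det: "det L \<noteq> 0"
  proof
    assume "det L = 0"
    then obtain v where v: "v \<in> carrier_vec d" "v \<noteq> 0\<^sub>v d" "L *\<^sub>v v = 0\<^sub>v d"
      using det_0_iff_vec_prod_zero_field[OF L] by auto
    define V where "V = map_poly complex_of_real (cofactor_pairing v)"
    have V: "poly V (b j) = (\<Sum>k<d. coeff (Q j) k * of_real (v $ k))" if "j \<in> {1..d}" for j
      unfolding V_def by (rule poly_cofactor_pairing[OF Q[OF that]])
    have Nv: "(\<Sum>k<d. coeff (Q j) k * of_real ((N *\<^sub>v v) $ k)) = (b j - \<beta>) * poly V (b j)"
      if "j \<in> {1..d}" for j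
      using pow[OF that v(1), of 0] v(1) companion_matrix_carrier V[OF that] by simp
    have first: "poly V (b j) = 0" if j: "j \<in> {1..p + s}" for j
    proof -
      have j': "j \<in> {1..d}" using j assms(6) by auto
      have "(\<Sum>k<d. coeff (Q j) k * of_real ((N *\<^sub>v v) $ k)) = 0"
      proof (rule real_coord_eq_0D[OF _ j])
        show "real_coord p (\<lambda>j. \<Sum>k<d. coeff (Q j) k * of_real ((N *\<^sub>v v) $ k)) i = 0" if "i < p + 2 * s" for i
          using L_index[OF v(1), of i] that v(3) assms(6) by simp
        assume "j \<le> p"
        then have "b j \<in> \<real>" using assms(8) j by simp
        \<comment> \<open>At a real conjugate the value of \<open>V\<close> is real, so a vanishing
          real part means a vanishing value.\<close>
        then obtain c where c: "b j = of_real c" by (rule Reals_cases)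
        have "poly V (b j) = of_real (poly (cofactor_pairing v) c)"
          unfolding V_def c by (rule of_real_hom.poly_map_poly)
        then show "(\<Sum>k<d. coeff (Q j) k * of_real ((N *\<^sub>v v) $ k)) \<in> \<real>"
          unfolding Nv[OF j'] by (simp add: c)
      qed
      \<comment> \<open>The factor \<open>b j - \<beta>\<close> cancels because the conjugates in
        question differ from \<beta>.\<close>
      then show ?thesis using Nv[OF j'] conj(2)[OF j'] by simp
    qed
    have "poly V (b j) = 0" if j: "j \<in> {1..d}" for j
    proof (cases "j \<le> p + s")
      case True
      then show ?thesis using first j by simp
    next
      case False
      define i where "i = j - p - s"
      have i: "i \<in> {1..s}" "j = p + s + i" using False j assms(6) by (auto simp: i_def)
      then have "cnj (poly V (b j)) = poly V (b (p + i))"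
        using assms(10) by (simp add: V_def poly_cnj_real)
      then show ?thesis using first[of "p + i"] i by simp
    qed
    then have "v = 0\<^sub>v d"
      using card_image[OF inj] by (intro cofactor_pairing_eq_0[OF v(1), of "b ` {1..d}"]) (auto simp: V_def)
    with v(2) show False by simp
  qed
  \<comment> \<open>A single base for the error at all conjugates; the maximum exists because
    \<open>d \<ge> 1\<close>.\<close>
  define \<rho> where "\<rho> = Max ((\<lambda>j. cmod (b j)) ` {1..d})"
  have \<rho>_ge: "cmod (b j) \<le> \<rho>" if "j \<in> {1..d}" for j
    unfolding \<rho>_def by (rule Max_ge) (use that in auto)
  have "\<rho> < 1"
    unfolding \<rho>_def by (subst Max_less_iff) (use b_less_1 assms(1) in auto)
  have "\<rho> \<ge> 0" using order_trans[OF norm_ge_zero \<rho>_ge[of 1]] assms(1) by simp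
  define f where "f n z = Phi \<beta> b p s (\<beta> ^ n * residue z)" for n z
  define g where "g n z = companion_matrix r ^\<^sub>m n *\<^sub>v map_vec real_of_int z" for n z
  have g: "g n z \<in> carrier_vec d" if "z \<in> srs_preimage r n x" for n z
    unfolding g_def
    by (rule mult_mat_vec_carrier[OF pow_carrier_mat[OF companion_matrix_carrier]])
      (use that r_carrier in \<open>auto simp: srs_preimage_def\<close>)
  have f: "f n z \<in> carrier_vec d" for n z by (simp add: f_def Phi_def assms(6))
  have fg: "\<bar>f n z $ i - (L *\<^sub>v g n z) $ i\<bar> \<le> \<rho> ^ n" if z: "z \<in> srs_preimage r n x" and i: "i < d" for n z i
  proof -
    have z': "z \<in> carrier_vec d" "map_vec real_of_int z \<in> carrier_vec d"
      using z r_carrier by (auto simp: srs_preimage_def)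
    define A where "A j = conj_iso \<beta> (b j) (\<beta> ^ n * residue z)" for j
    define B where "B j = (\<Sum>k<d. coeff (Q j) k * of_real ((N *\<^sub>v g n z) $ k))" for j
    \<comment> \<open>The main terms cancel, leaving \<open>b j ^ n * residue z\<close>. As residues
      lie in the unit interval, the bound is uniform in \<open>z\<close>.\<close>
    have diff: "cmod (A j - B j) \<le> \<rho> ^ n" if j: "j \<in> {1..p + s}" for j
    proof -
      have j': "j \<in> {1..d}" using j assms(6) by auto
      have "B j = (b j - \<beta>) * (b j ^ n * (\<Sum>k<d. coeff (Q j) k * of_int (z $ k)))"
        unfolding B_def g_def pow[OF j' z'(2)] using z'(1) by simp
      then have "A j - B j = b j ^ n * residue z"
        unfolding A_def conj_iso_residue[OF z'(1) Q[OF j']] by (simp add: algebra_simps)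
      then have "cmod (A j - B j) = cmod (b j) ^ n * \<bar>residue z\<bar>"
        by (simp add: norm_mult norm_power)
      also have "\<dots> \<le> cmod (b j) ^ n"
        using frac_lt_1[of "r \<bullet> map_vec of_int z"] by (intro mult_left_le) (simp_all add: residue_def)
      also have "\<dots> \<le> \<rho> ^ n" using \<rho>_ge[OF j'] by (simp add: power_mono)
      finally show ?thesis .
    qed
    have "f n z $ i = real_coord p A i" using i by (simp add: f_def Phi_def A_def[abs_def] assms(6))
    moreover have "(L *\<^sub>v g n z) $ i = real_coord p B i" using L_index[OF g[OF z] i] by (simp add: B_def[abs_def])
    moreover have "\<bar>real_coord p A i - real_coord p B i\<bar> \<le> \<rho> ^ n"
    proof (rule real_coord_cases[of i p s])
      show "i < p + 2 * s" using i assms(6) by simp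
    next
      fix j assume j: "j \<in> {1..p + s}" "\<And>w. real_coord p w i = Re (w j)"
      show ?thesis using abs_Re_le_cmod[of "A j - B j"] diff[OF j(1)] by (simp add: j(2))
    next
      fix j assume j: "j \<in> {1..p + s}" "\<And>w. real_coord p w i = Im (w j)"
      show ?thesis using abs_Im_le_cmod[of "A j - B j"] diff[OF j(1)] by (simp add: j(2))
    qed
    ultimately show ?thesis by simp
  qed
  have "integral_beta_tile \<beta> b p s (frac (r \<bullet> map_vec of_int x)) =
      lower_hausdorff_limit d (\<lambda>n. f n ` srs_preimage r n x)"
    unfolding integral_beta_tile_def residue_def[symmetric] beta_preimage_residue[OF x] image_image f_def assms(6) ..
  also have "\<dots> = (\<lambda>t. L *\<^sub>v t) ` lower_hausdorff_limit d (\<lambda>n. g n ` srs_preimage r n x)"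
    by (rule lower_hausdorff_limit_linear_image_eq[OF L det g f _ fg])
      (use \<open>\<rho> \<ge> 0\<close> \<open>\<rho> < 1\<close> in \<open>auto intro: LIMSEQ_realpow_zero\<close>)
  also have "lower_hausdorff_limit d (\<lambda>n. g n ` srs_preimage r n x) = srs_tile r x"
    using r_carrier by (simp add: srs_tile_def g_def)
  finally show "integral_beta_tile \<beta> b p s (frac (r \<bullet> map_vec of_int x)) =
      (\<lambda>t. (U_matrix p s q * (companion_matrix r - \<beta> \<cdot>\<^sub>m 1\<^sub>m d)) *\<^sub>v t) ` srs_tile r x"
    unfolding L_def N_def .
qed

end
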